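(* Suppose that $(\mathcal A,\varphi)$ is a $W^*$-probability space. Let $(y(s))_{s\in\mathbb N}$ be a family of normal elements of $\mathcal A$, and let $\mathcal B$ be a subalgebra of $\mathcal A$ which contains $\mathcal D$ and such that the family $(\mathcal B,(\{y(s)\})_{s\in\mathbb N})$ is $\varphi$-free. Then the family $(\mathcal B,(\{y(s)\})_{s\in\mathbb N})$ is also free with amalgamation over $\mathcal D$.
   Context: $(\mathcal A,\varphi)$ is a tracial $W^*$-probability space (von Neumann algebra with faithful normal tracial state) with self-adjoint nonzero pairwise orthogonal projections $p_1,\dots,p_d$, $p_1+\cdots+p_d=1$; $\rho_i=\varphi(p_i)$, $\mathcal D=\mathrm{Span}\{p_1,\dots,p_d\}$, $\varphi_i=\rho_i^{-1}\varphi|_{p_i\mathcal Ap_i}$, and $E:\mathcal A\to\mathcal D$, $E(x)=\sum_i\varphi_i(p_ixp_i)p_i$, is the conditional expectation onto $\mathcal D$. $\varphi$-freeness is ordinary freeness: $*$-subalgebras $(\mathcal A_i)_{i\in I}$ are $\varphi$-free if $\varphi(x(1)\cdots x(n))=0$ whenever $i_1\neq i_2\ne\cdots\ne i_n$ (consecutive indices distinct) and $x(j)\in\mathcal A_{i_j}\cap\ker\varphi$. $*$-subalgebras $(\mathcal A_i)_{i\in I}$ all containing $\mathcal D$ are free with amalgamation over $\mathcal D$ if $E(x(1)\cdots x(n))=0$ whenever $i_1\ne\cdots\ne i_n$ (consecutive indices distinct) and $x(j)\in\mathcal A_{i_j}\cap\ker E$. A family of subsets $(\chi_i)$ is $\varphi$-free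 (resp. free with amalgamation over $\mathcal D$) if there are $\varphi$-free $*$-subalgebras (resp. $*$-subalgebras containing $\mathcal D$ and free with amalgamation over $\mathcal D$) $\mathcal A_i\supset\chi_i$. *)

theory Defs
  imports "HOL-Analysis.Analysis"
begin

section \<open>Complex Hilbert spaces\<close>

class scaleC =
  fixes scaleC :: "complex \<Rightarrow> 'a \<Rightarrow> 'a"  (infixr \<open>*\<^sub>C\<close> 75)

text \<open>The inner product is linear in its first argument. Its real part is the inner product of
  the underlying real inner product space, so positive definiteness and the identity
  \<open>(norm x)\<^sup>2 = cinner x x\<close> are inherited from \<^class>\<open>real_inner\<close>.\<close>

class complex_inner = real_inner + scaleC +
  fixes cinner :: "'a \<Rightarrow> 'a \<Rightarrow> complex"
  assumes scaleC_add_right: "c *\<^sub>C (x + y) = c *\<^sub>C x + c *\<^sub>C y"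
    and scaleC_add_left: "(b + c) *\<^sub>C x = b *\<^sub>C x + c *\<^sub>C x"
    and scaleC_scaleC: "b *\<^sub>C c *\<^sub>C x = (b * c) *\<^sub>C x"
    and scaleC_of_real: "complex_of_real r *\<^sub>C x = r *\<^sub>R x"
    and cinner_commute: "cinner x y = cnj (cinner y x)"
    and cinner_add_left: "cinner (x + y) z = cinner x z + cinner y z"
    and cinner_scaleC_left: "cinner (c *\<^sub>C x) y = c * cinner x y"
    and Re_cinner: "Re (cinner x y) = inner x y"

class chilbert_space = complex_inner + complete_space

lemma scaleC_one [simp]: "1 *\<^sub>C x = (x :: 'a::complex_inner)"
  using scaleC_of_real[of 1 x] by simp

lemma scaleC_zero_right [simp]: "c *\<^sub>C 0 = (0 :: 'a::complex_inner)"
  using scaleC_add_right[of c "0 :: 'a" 0] by simp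

lemma scaleC_minus_right: "c *\<^sub>C (- x) = - (c *\<^sub>C (x :: 'a::complex_inner))"
  using scaleC_add_right[of c x "- x"] by (simp add: eq_neg_iff_add_eq_0 add.commute)

lemma scaleC_diff_right: "c *\<^sub>C (x - y) = c *\<^sub>C x - c *\<^sub>C (y :: 'a::complex_inner)"
  using scaleC_add_right[of c x "- y"] by (simp add: scaleC_minus_right)

lemma cinner_add_right: "cinner (x :: 'a::complex_inner) (y + z) = cinner x y + cinner x z"
  using cinner_commute[of x "y + z"] cinner_commute[of x y] cinner_commute[of x z]
  by (simp add: cinner_add_left)

lemma cinner_scaleC_right: "cinner (x :: 'a::complex_inner) (c *\<^sub>C y) = cnj c * cinner x y"
  using cinner_commute[of x "c *\<^sub>C y"] cinner_commute[of x y]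
  by (simp add: cinner_scaleC_left)

lemma norm_scaleC: "norm (c *\<^sub>C x) = norm c * norm (x :: 'a::complex_inner)"
proof -
  have im: "Im (cinner x x) = 0"
    using arg_cong[OF cinner_commute[of x x], of Im] by simp
  have "inner (c *\<^sub>C x) (c *\<^sub>C x) = Re ((c * cnj c) * cinner x x)"
    by (simp add: Re_cinner[symmetric] cinner_scaleC_left cinner_scaleC_right ac_simps
        del: complex_mult_cnj times_complex.sel)
  also have "\<dots> = (norm c)\<^sup>2 * inner x x"
    by (simp add: im Re_cinner complex_mult_cnj cmod_power2)
  finally show ?thesis
    by (simp add: norm_eq_sqrt_inner real_sqrt_mult)
qed


section \<open>The algebra of bounded operators\<close>

typedef (overloaded) ('a::complex_inner) bop =
  "{f :: 'a \<Rightarrow> 'a. bounded_linear f \<and> (\<forall>c u. f (c *\<^sub>C u) = c *\<^sub>C f u)}"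
  morphisms app_bop Bop
  by (intro exI[of _ "\<lambda>_. 0"]) simp

setup_lifting type_definition_bop

instantiation bop :: (complex_inner) "{ring, monoid_mult, scaleC}"
begin

lift_definition zero_bop :: "'a bop" is "\<lambda>_. 0" by simp
lift_definition one_bop :: "'a bop" is "\<lambda>u. u" by (simp add: bounded_linear_ident)
lift_definition plus_bop :: "'a bop \<Rightarrow> 'a bop \<Rightarrow> 'a bop" is "\<lambda>f g u. f u + g u"
  by (simp add: bounded_linear_add scaleC_add_right)
lift_definition uminus_bop :: "'a bop \<Rightarrow> 'a bop" is "\<lambda>f u. - f u"
  by (simp add: bounded_linear_minus scaleC_minus_right)
lift_definition minus_bop :: "'a bop \<Rightarrow> 'a bop \<Rightarrow> 'a bop" is "\<lambda>f g u. f u - g u"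
  by (simp add: bounded_linear_sub scaleC_diff_right)
lift_definition times_bop :: "'a bop \<Rightarrow> 'a bop \<Rightarrow> 'a bop" is "\<lambda>f g u. f (g u)"
  by (simp add: bounded_linear_compose)
lift_definition scaleC_bop :: "complex \<Rightarrow> 'a bop \<Rightarrow> 'a bop" is "\<lambda>c f u. c *\<^sub>C f u"
proof -
  fix c :: complex and f :: "'a \<Rightarrow> 'a"
  assume f: "bounded_linear f \<and> (\<forall>c u. f (c *\<^sub>C u) = c *\<^sub>C f u)"
  have comm: "c *\<^sub>C r *\<^sub>R x = r *\<^sub>R c *\<^sub>C x" for r and x :: 'a
    by (simp only: scaleC_of_real[symmetric] scaleC_scaleC mult.commute)
  have "bounded_linear (\<lambda>x::'a. c *\<^sub>C x)"
    by (rule bounded_linear_intro[where K = "norm c"])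
      (auto simp: scaleC_add_right comm norm_scaleC mult.commute)
  then have "bounded_linear (\<lambda>u. c *\<^sub>C f u)"
    using f by (auto intro: bounded_linear_compose)
  then show "bounded_linear (\<lambda>u. c *\<^sub>C f u) \<and> (\<forall>d u. c *\<^sub>C f (d *\<^sub>C u) = d *\<^sub>C c *\<^sub>C f u)"
    using f by (simp add: scaleC_scaleC mult.commute)
qed

instance
  by standard
    (transfer, simp add: fun_eq_iff algebra_simps linear_add[OF bounded_linear.linear])+

end

text \<open>The Hilbert space adjoint. On a \<^class>\<open>chilbert_space\<close> it exists for every bounded operator
  by the Riesz representation theorem; it is unique because the inner product is definite.\<close>

definition star :: "'h::chilbert_space bop \<Rightarrow> 'h bop" where
  "star x = (THE y. \<forall>u v. cinner (app_bop x u) v = cinner u (app_bop y v))"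

definition positive_op :: "'h::chilbert_space bop \<Rightarrow> bool" where
  "positive_op x \<longleftrightarrow> (\<forall>u. cinner (app_bop x u) u \<in> \<real> \<and> 0 \<le> Re (cinner (app_bop x u) u))"

definition op_le :: "'h::chilbert_space bop \<Rightarrow> 'h bop \<Rightarrow> bool" where
  "op_le x y \<longleftrightarrow> positive_op (y - x)"


section \<open>Subalgebras and von Neumann algebras\<close>

definition subalgebra_of :: "'h::chilbert_space bop set \<Rightarrow> 'h bop set \<Rightarrow> bool" where
  "subalgebra_of A B \<longleftrightarrow> B \<subseteq> A \<and> 0 \<in> B \<and> (\<forall>x\<in>B. \<forall>y\<in>B. x + y \<in> B) \<and>
     (\<forall>c. \<forall>x\<in>B. c *\<^sub>C x \<in> B) \<and> (\<forall>x\<in>B. \<forall>y\<in>B. x * y \<in> B)"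

definition star_subalgebra_of :: "'h::chilbert_space bop set \<Rightarrow> 'h bop set \<Rightarrow> bool" where
  "star_subalgebra_of A B \<longleftrightarrow> subalgebra_of A B \<and> 1 \<in> B \<and> (\<forall>x\<in>B. star x \<in> B)"

definition commutant :: "'h::chilbert_space bop set \<Rightarrow> 'h bop set" where
  "commutant M = {x. \<forall>y\<in>M. x * y = y * x}"

definition von_neumann_algebra :: "'h::chilbert_space bop set \<Rightarrow> bool" where
  "von_neumann_algebra M \<longleftrightarrow> star_subalgebra_of UNIV M \<and> commutant (commutant M) = M"


section \<open>Tracial W*-probability spaces\<close>

text \<open>A functional on \<open>A\<close> is a function on all bounded operators of which only the values on \<open>A\<close>
  matter.\<close>

definition state_on :: "'h::chilbert_space bop set \<Rightarrow> ('h bop \<Rightarrow> complex) \<Rightarrow> bool" where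
  "state_on A \<phi> \<longleftrightarrow>
     (\<forall>x\<in>A. \<forall>y\<in>A. \<phi> (x + y) = \<phi> x + \<phi> y) \<and> (\<forall>c. \<forall>x\<in>A. \<phi> (c *\<^sub>C x) = c * \<phi> x) \<and>
     (\<forall>x\<in>A. \<phi> (star x * x) \<in> \<real> \<and> 0 \<le> Re (\<phi> (star x * x))) \<and> \<phi> 1 = 1"

definition op_sup_in :: "'h::chilbert_space bop set \<Rightarrow> 'h bop set \<Rightarrow> 'h bop \<Rightarrow> bool" where
  "op_sup_in A S x \<longleftrightarrow> x \<in> A \<and> star x = x \<and> (\<forall>s\<in>S. op_le s x) \<and>
     (\<forall>y\<in>A. star y = y \<and> (\<forall>s\<in>S. op_le s y) \<longrightarrow> op_le x y)"

text \<open>Normality: suprema of upward directed, bounded sets of self-adjoint elements are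
  preserved.\<close>

definition normal_on :: "'h::chilbert_space bop set \<Rightarrow> ('h bop \<Rightarrow> complex) \<Rightarrow> bool" where
  "normal_on A \<phi> \<longleftrightarrow>
     (\<forall>S x. S \<subseteq> A \<and> S \<noteq> {} \<and> (\<forall>s\<in>S. star s = s) \<and>
        (\<forall>a\<in>S. \<forall>b\<in>S. \<exists>c\<in>S. op_le a c \<and> op_le b c) \<and> op_sup_in A S x \<longrightarrow>
        Re (\<phi> x) = (SUP s\<in>S. Re (\<phi> s)))"

definition faithful_on :: "'h::chilbert_space bop set \<Rightarrow> ('h bop \<Rightarrow> complex) \<Rightarrow> bool" where
  "faithful_on A \<phi> \<longleftrightarrow> (\<forall>x\<in>A. \<phi> (star x * x) = 0 \<longrightarrow> x = 0)"

definition tracial_on :: "'h::chilbert_space bop set \<Rightarrow> ('h bop \<Rightarrow> complex) \<Rightarrow> bool" where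
  "tracial_on A \<phi> \<longleftrightarrow> (\<forall>x\<in>A. \<forall>y\<in>A. \<phi> (x * y) = \<phi> (y * x))"

definition tracial_wstar_prob_space ::
    "'h::chilbert_space bop set \<Rightarrow> ('h bop \<Rightarrow> complex) \<Rightarrow> bool" where
  "tracial_wstar_prob_space A \<phi> \<longleftrightarrow> von_neumann_algebra A \<and>
     state_on A \<phi> \<and> normal_on A \<phi> \<and> faithful_on A \<phi> \<and> tracial_on A \<phi>"


section \<open>The diagonal subalgebra and the conditional expectation\<close>

definition orthogonal_projection_partition ::
    "'h::chilbert_space bop set \<Rightarrow> nat \<Rightarrow> (nat \<Rightarrow> 'h bop) \<Rightarrow> bool" where
  "orthogonal_projection_partition A d p \<longleftrightarrow>
     (\<forall>i\<in>{1..d}. p i \<in> A \<and> star (p i) = p i \<and> p i * p i = p i \<and> p i \<noteq> 0) \<and>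
     (\<forall>i\<in>{1..d}. \<forall>j\<in>{1..d}. i \<noteq> j \<longrightarrow> p i * p j = 0) \<and> (\<Sum>i=1..d. p i) = 1"

definition diag_alg :: "nat \<Rightarrow> (nat \<Rightarrow> 'h::chilbert_space bop) \<Rightarrow> 'h bop set" where
  "diag_alg d p = {\<Sum>i=1..d. c i *\<^sub>C p i | c :: nat \<Rightarrow> complex. True}"

text \<open>\<open>corner_state \<phi> p i\<close> is the normalized restriction of \<open>\<phi>\<close> to the corner \<open>p i * A * p i\<close>.\<close>

definition corner_state ::
    "('h::chilbert_space bop \<Rightarrow> complex) \<Rightarrow> (nat \<Rightarrow> 'h bop) \<Rightarrow> nat \<Rightarrow> 'h bop \<Rightarrow> complex" where
  "corner_state \<phi> p i x = inverse (\<phi> (p i)) * \<phi> x"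

definition cond_exp ::
    "('h::chilbert_space bop \<Rightarrow> complex) \<Rightarrow> nat \<Rightarrow> (nat \<Rightarrow> 'h bop) \<Rightarrow> 'h bop \<Rightarrow> 'h bop" where
  "cond_exp \<phi> d p x = (\<Sum>i=1..d. corner_state \<phi> p i (p i * x * p i) *\<^sub>C p i)"


section \<open>Freeness\<close>

text \<open>\<open>free_wrt F\<close> is the vanishing condition on alternating centred words, common to
  \<open>\<phi>\<close>-freeness (\<open>F = \<phi>\<close>) and freeness with amalgamation (\<open>F = E\<close>). A word is a nonempty list of
  letters, each tagged with the index of the algebra it is taken from.\<close>

definition free_wrt ::
    "('h::chilbert_space bop \<Rightarrow> 'c::zero) \<Rightarrow> ('i \<Rightarrow> 'h bop set) \<Rightarrow> bool" where
  "free_wrt F \<A> \<longleftrightarrow>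
     (\<forall>w :: ('i \<times> 'h bop) list. w \<noteq> [] \<and> distinct_adj (map fst w) \<and>
        (\<forall>(i, x) \<in> set w. x \<in> \<A> i \<and> F x = 0) \<longrightarrow> F (prod_list (map snd w)) = 0)"

text \<open>The *-subalgebras witnessing \<open>\<phi>\<close>-freeness are unital, as usual in free probability. Without
  this convention the algebra spanned by a single proper projection would meet the kernel of a
  faithful state only in \<open>0\<close>, and the vanishing condition would be void for it.\<close>

definition phi_free ::
    "'h::chilbert_space bop set \<Rightarrow> ('h bop \<Rightarrow> complex) \<Rightarrow> ('i \<Rightarrow> 'h bop set) \<Rightarrow> bool" where
  "phi_free A \<phi> X \<longleftrightarrow>
     (\<exists>\<A>. (\<forall>i. star_subalgebra_of A (\<A> i) \<and> X i \<subseteq> \<A> i) \<and> free_wrt \<phi> \<A>)"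

definition free_amalgamated ::
    "'h::chilbert_space bop set \<Rightarrow> ('h bop \<Rightarrow> complex) \<Rightarrow> nat \<Rightarrow> (nat \<Rightarrow> 'h bop) \<Rightarrow>
     ('i \<Rightarrow> 'h bop set) \<Rightarrow> bool" where
  "free_amalgamated A \<phi> d p X \<longleftrightarrow>
     (\<exists>\<A>. (\<forall>i. star_subalgebra_of A (\<A> i) \<and> diag_alg d p \<subseteq> \<A> i \<and> X i \<subseteq> \<A> i) \<and>
          free_wrt (cond_exp \<phi> d p) \<A>)"

text \<open>The family consisting of \<open>B\<close> together with the singletons \<open>{y s}\<close>.\<close>

definition adjoin_singletons ::
    "'h bop set \<Rightarrow> (nat \<Rightarrow> 'h bop) \<Rightarrow> nat option \<Rightarrow> 'h::chilbert_space bop set" where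
  "adjoin_singletons B y k = (case k of None \<Rightarrow> B | Some s \<Rightarrow> {y s})"

end

theory Submission
  imports Defs
begin

text \<open>
  Let \<open>\<A> k \<supseteq> D\<close> and \<open>\<A> s\<close>, \<open>s \<noteq> k\<close>, be \<open>\<phi>\<close>-free. The witnesses for
  freeness with amalgamation are \<open>\<A> k\<close> and the algebras \<open>alg(D, \<A> s)\<close>.

  By traciality, \<open>E x = 0\<close> iff \<open>\<phi> (q x) = 0\<close> for all \<open>q \<in> D\<close>. Splitting letters into a centred part and
  a scalar gives \<open>alg(D, \<A> s) = D + V\<close>, where \<open>V\<close> is spanned by the words \<open>q\<^sub>0 a\<^sub>1 q\<^sub>1 \<dots> a\<^sub>n q\<^sub>n\<close> with
  \<open>n \<ge> 1\<close>, centred \<open>a\<^sub>j \<in> \<A> s\<close>, \<open>q\<^sub>j \<in> D\<close> and centred inner \<open>q\<^sub>j\<close>. Freeness gives \<open>E = 0\<close> on \<open>V\<close>, so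
  \<open>V\<close> is the kernel of \<open>E\<close> in \<open>alg(D, \<A> s)\<close>. In an alternating product of elements of these kernels
  the factors meet in elements \<open>q b r\<close> of \<open>\<A> k\<close> with \<open>q, r \<in> D\<close> and \<open>E b = 0\<close>, which are centred because
  \<open>E (q b r) = q E(b) r\<close>, or in elements of \<open>D\<close> between letters of two different algebras, whose
  scalar part does no harm. Either way \<open>\<phi>\<close>-freeness applies to the resulting words.
\<close>

section \<open>Adjoints\<close>

text \<open>The representing vector is the minimizer of \<open>\<lambda>u. \<parallel>u\<parallel>\<^sup>2 - 2 f u\<close>; by the parallelogram law every
  minimizing sequence is Cauchy.\<close>

lemma riesz_representation_real:
  fixes f :: "'a::{real_inner,complete_space} \<Rightarrow> real"
  assumes "bounded_linear f"
  shows "\<exists>w. \<forall>u. f u = inner u w"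
proof -
  interpret f: bounded_linear f by fact
  define g where "g u = inner u u - 2 * f u" for u
  obtain M where M: "\<And>u. norm (f u) \<le> norm u * M" using f.bounded by blast
  have lower: "- (M\<^sup>2) \<le> g u" for u
  proof -
    have "0 \<le> (norm u - M)\<^sup>2" by simp
    moreover have "f u \<le> norm u * M" using M[of u] by simp
    ultimately show ?thesis
      unfolding g_def power2_norm_eq_inner[symmetric] by (simp add: power2_diff algebra_simps)
  qed
  define m where "m = Inf (range g)"
  have bdd: "bdd_below (range g)" using lower by (rule bdd_belowI2)
  have m_le: "m \<le> g u" for u unfolding m_def using bdd by (simp add: cInf_lower)
  have "\<exists>u. g u < m + e" if "e > 0" for e
    using cInf_lessD[of "range g" "m + e"] that unfolding m_def by auto
  then have "\<exists>u. g u < m + inverse (real (Suc n))" for n by simp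
  then obtain X where X: "\<And>n. g (X n) < m + inverse (real (Suc n))" by metis
  have parallelogram: "inner (u - v) (u - v) = 2 * g u + 2 * g v - 4 * g ((1/2) *\<^sub>R (u + v))" for u v
    unfolding g_def by (simp add: inner_add inner_diff inner_commute f.add f.scaleR algebra_simps)
  have "Cauchy X"
  proof (rule metric_CauchyI)
    fix e :: real assume "e > 0"
    \<comment> \<open>Two values of \<open>g\<close> within \<open>e^2/4\<close> of
      \<open>m\<close>, with the midpoint value at least \<open>m\<close>, bound the squared
      distance by \<open>4 * (e^2/4)\<close>.\<close>
    then obtain n0 where n0: "inverse (real (Suc n0)) < e\<^sup>2 / 4"
      using reals_Archimedean[of "e\<^sup>2 / 4"] by auto
    have "dist (X i) (X j) < e" if "i \<ge> n0" "j \<ge> n0" for i j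
    proof -
      have "inverse (real (Suc i)) \<le> inverse (real (Suc n0))"
        "inverse (real (Suc j)) \<le> inverse (real (Suc n0))"
        using that by (simp_all add: le_imp_inverse_le)
      then have "inner (X i - X j) (X i - X j) < e\<^sup>2"
        using parallelogram[of "X i" "X j"] X[of i] X[of j] n0 m_le[of "(1/2) *\<^sub>R (X i + X j)"]
        by linarith
      then have "(norm (X i - X j))\<^sup>2 < e\<^sup>2" by (simp add: power2_norm_eq_inner)
      then show ?thesis using \<open>e > 0\<close> by (simp add: dist_norm power2_less_imp_less)
    qed
    then show "\<exists>n. \<forall>i\<ge>n. \<forall>j\<ge>n. dist (X i) (X j) < e" by blast
  qed
  then obtain w where w: "X \<longlonglongrightarrow> w" using Cauchy_convergent convergent_def by blast
  have "(\<lambda>n. g (X n)) \<longlonglongrightarrow> g w"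
    unfolding g_def by (intro tendsto_intros w f.tendsto)
  moreover have "(\<lambda>n. m + inverse (real (Suc n))) \<longlonglongrightarrow> m"
    using tendsto_add[OF tendsto_const LIMSEQ_inverse_real_of_nat, of m] by simp
  ultimately have gw: "g w \<le> m"
    by (rule LIMSEQ_le) (use X in \<open>auto intro: less_imp_le\<close>)
  have "f h = inner h w" for h
  proof (rule ccontr)
    \<comment> \<open>The step \<open>t = - c / N\<close> below makes the quadratic increment of
      \<open>g\<close> negative; the summand 1 keeps \<open>N\<close> positive without a case
      distinction on \<open>h\<close>.\<close>
    define c N where "c = inner h w - f h" and "N = inner h h + 1"
    assume "f h \<noteq> inner h w"
    then have c: "c \<noteq> 0" by (simp add: c_def)
    have N: "N > 0" by (simp add: N_def add_nonneg_pos)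
    have "g (w + t *\<^sub>R h) = g w + 2 * t * c + t\<^sup>2 * (N - 1)" for t
      unfolding g_def c_def N_def
      by (simp add: inner_add inner_commute f.add f.scaleR algebra_simps power2_eq_square)
    then have "0 \<le> 2 * t * c + t\<^sup>2 * (N - 1)" for t using gw m_le[of "w + t *\<^sub>R h"] by simp
    from this[of "- c / N"] have "0 \<le> 2 * (- c / N) * c + (- c / N)\<^sup>2 * (N - 1)" .
    also have "\<dots> = - (c\<^sup>2 * (N + 1) / N\<^sup>2)"
      using N by (simp add: field_simps power2_eq_square)
    finally have "0 \<le> - (c\<^sup>2 * (N + 1) / N\<^sup>2)" .
    moreover have "0 < c\<^sup>2 * (N + 1) / N\<^sup>2" using c N by simp
    ultimately show False by simp
  qed
  then show ?thesis by blast
qed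

lemma cinner_eqI:
  fixes v w :: "'h::complex_inner"
  assumes "\<And>u. cinner u v = cinner u w"
  shows "v = w"
proof -
  have "inner u v = inner u w" for u using assms[of u] by (metis Re_cinner)
  then show ?thesis using vector_eq_ldot by blast
qed

lemma Im_cinner: "Im (cinner u (v :: 'h::complex_inner)) = - inner (\<i> *\<^sub>C u) v"
  by (simp add: Re_cinner[symmetric] cinner_scaleC_left)

lemma bounded_linear_app_bop: "bounded_linear (app_bop x)"
  and app_bop_scaleC: "app_bop x (c *\<^sub>C u) = c *\<^sub>C app_bop x u"
  using app_bop[of x] by auto

text \<open>For fixed \<open>v\<close>, Riesz applies to the real functional
  \<open>inner (app_bop x u) v\<close> of \<open>u\<close>. Imaginary parts follow by testing with
  \<i> times \<open>u\<close>, as \<open>x\<close> is complex linear; boundedness of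
  \<open>g\<close> is Cauchy-Schwarz at \<open>u = g v\<close>.\<close>

lemma adjoint_exists:
  fixes x :: "'h::chilbert_space bop"
  shows "\<exists>y :: 'h bop. \<forall>u v. cinner (app_bop x u) v = cinner u (app_bop y v)"
proof -
  have "\<exists>w. \<forall>u. inner (app_bop x u) v = inner u w" for v
    by (rule riesz_representation_real)
      (intro bounded_linear_compose[OF bounded_linear_inner_left] bounded_linear_app_bop)
  then obtain g where g: "\<And>u v. inner (app_bop x u) v = inner u (g v)" by metis
  have adj: "cinner (app_bop x u) v = cinner u (g v)" for u v
    by (rule complex_eqI) (simp_all add: Re_cinner Im_cinner g flip: app_bop_scaleC)
  obtain K where K: "\<And>u. norm (app_bop x u) \<le> norm u * K"
    using bounded_linear.bounded[OF bounded_linear_app_bop] by blast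
  have "bounded_linear g"
  proof (rule bounded_linear_intro)
    show "g (v + w) = g v + g w" for v w
      by (rule cinner_eqI) (simp add: adj[symmetric] cinner_add_right)
    show "g (r *\<^sub>R v) = r *\<^sub>R g v" for r v
      by (rule cinner_eqI) (simp add: adj[symmetric] cinner_scaleC_right flip: scaleC_of_real)
    show "norm (g v) \<le> norm v * K" for v
    proof (cases "g v = 0")
      case True
      have "0 \<le> norm v * K" using norm_ge_zero K[of v] by (rule order_trans)
      with True show ?thesis by simp
    next
      case False
      have "norm (g v) * norm (g v) = inner (app_bop x (g v)) v"
        by (simp add: g flip: power2_norm_eq_inner power2_eq_square)
      also have "\<dots> \<le> norm (app_bop x (g v)) * norm v" by (rule norm_cauchy_schwarz)
      also have "\<dots> \<le> norm (g v) * K * norm v" using K by (simp add: mult_right_mono)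
      finally show ?thesis using False by (simp add: mult.commute)
    qed
  qed
  moreover have "g (c *\<^sub>C v) = c *\<^sub>C g v" for c v
    by (rule cinner_eqI) (simp add: adj[symmetric] cinner_scaleC_right)
  ultimately have "app_bop (Bop g) = g" by (simp add: Bop_inverse)
  with adj show ?thesis by metis
qed

lemma bop_eqI: "(\<And>u. app_bop x u = app_bop y u) \<Longrightarrow> x = y"
  by (metis app_bop_inject ext)

text \<open>\<open>star\<close> is a definite description, so computing it requires uniqueness,
  which the definiteness of the inner product supplies.\<close>

lemma star_eqI:
  assumes "\<And>u v. cinner (app_bop x u) v = cinner u (app_bop y v)"
  shows "star x = y"
  unfolding star_def
proof (rule the_equality)
  fix z assume "\<forall>u v. cinner (app_bop x u) v = cinner u (app_bop z v)"
  then show "z = y" using assms by (intro bop_eqI cinner_eqI) metis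
qed (use assms in blast)

lemma cinner_star: "cinner (app_bop x u) v = cinner u (app_bop (star x) v)"
  by (metis adjoint_exists star_eqI)

lemma star_add: "star (x + y) = star x + star y"
  by (rule star_eqI)
    (simp add: plus_bop.rep_eq cinner_add_left cinner_add_right flip: cinner_star)

lemma star_zero: "star 0 = 0"
  using star_add[of 0 0] by simp

lemma star_sum: "star (sum f S) = (\<Sum>i\<in>S. star (f i))"
  by (induction S rule: infinite_finite_induct) (simp_all add: star_add star_zero)

lemma star_scaleC: "star (c *\<^sub>C x) = cnj c *\<^sub>C star x"
  by (rule star_eqI)
    (simp add: scaleC_bop.rep_eq cinner_scaleC_left cinner_scaleC_right flip: cinner_star)

lemma star_mult: "star (x * y) = star y * star x"
  by (rule star_eqI) (simp add: times_bop.rep_eq flip: cinner_star)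

section \<open>Complex algebra structure\<close>

context
  fixes x y :: "'h::complex_inner bop"
begin

lemma bop_scaleC_add_right: "c *\<^sub>C (x + y) = c *\<^sub>C x + c *\<^sub>C y"
  by (rule bop_eqI) (simp add: scaleC_bop.rep_eq plus_bop.rep_eq scaleC_add_right)

lemma bop_scaleC_add_left: "(b + c) *\<^sub>C x = b *\<^sub>C x + c *\<^sub>C x"
  by (rule bop_eqI) (simp add: scaleC_bop.rep_eq plus_bop.rep_eq scaleC_add_left)

lemma bop_scaleC_scaleC: "b *\<^sub>C c *\<^sub>C x = (b * c) *\<^sub>C x"
  by (rule bop_eqI) (simp add: scaleC_bop.rep_eq scaleC_scaleC)

lemma bop_scaleC_one: "1 *\<^sub>C x = x"
  by (rule bop_eqI) (simp add: scaleC_bop.rep_eq)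

lemma bop_mult_scaleC_left: "(c *\<^sub>C x) * y = c *\<^sub>C (x * y)"
  by (rule bop_eqI) (simp add: scaleC_bop.rep_eq times_bop.rep_eq)

lemma bop_mult_scaleC_right: "x * (c *\<^sub>C y) = c *\<^sub>C (x * y)"
  by (rule bop_eqI) (simp add: scaleC_bop.rep_eq times_bop.rep_eq app_bop_scaleC)

lemma bop_scaleC_zero_left: "0 *\<^sub>C x = 0"
  using bop_scaleC_add_left[of 0 0] by simp

end

lemma bop_scaleC_zero_right: "c *\<^sub>C (0 :: 'h::complex_inner bop) = 0"
  using bop_scaleC_add_right[of c 0 0] by simp

lemma bop_scaleC_eq_0D:
  fixes x :: "'h::complex_inner bop"
  assumes "c *\<^sub>C x = 0" "x \<noteq> 0"
  shows "c = 0"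
  using assms bop_scaleC_scaleC[of "inverse c" c x]
  by (cases "c = 0") (simp_all add: bop_scaleC_one bop_scaleC_zero_right)

lemma bop_scaleC_sum_right:
  "c *\<^sub>C (sum f S :: 'h::complex_inner bop) = (\<Sum>i\<in>S. c *\<^sub>C f i)"
  by (induction S rule: infinite_finite_induct)
    (simp_all add: bop_scaleC_add_right bop_scaleC_zero_right)

lemmas bop_scaleC_simps = bop_scaleC_add_right bop_scaleC_scaleC bop_scaleC_one
  bop_mult_scaleC_left bop_mult_scaleC_right bop_scaleC_zero_left bop_scaleC_zero_right

text \<open>Unit and zero enter through \<open>1 \<in> S\<close> in
  \<open>star_subalgebra_generated\<close>, zero as 0 times the unit.\<close>

inductive_set generated_algebra :: "'h::chilbert_space bop set \<Rightarrow> 'h bop set" for S where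
  base: "x \<in> S \<Longrightarrow> x \<in> generated_algebra S"
| add: "x \<in> generated_algebra S \<Longrightarrow> y \<in> generated_algebra S \<Longrightarrow> x + y \<in> generated_algebra S"
| scaleC: "x \<in> generated_algebra S \<Longrightarrow> c *\<^sub>C x \<in> generated_algebra S"
| mult: "x \<in> generated_algebra S \<Longrightarrow> y \<in> generated_algebra S \<Longrightarrow> x * y \<in> generated_algebra S"

lemma star_subalgebra_generated:
  assumes "star_subalgebra_of UNIV A" "S \<subseteq> A" "1 \<in> S" "\<And>x. x \<in> S \<Longrightarrow> star x \<in> S"
  shows "star_subalgebra_of A (generated_algebra S)"
proof -
  have "x \<in> A" if "x \<in> generated_algebra S" for x
    using that by induction (use assms in \<open>auto simp: star_subalgebra_of_def subalgebra_of_def\<close>)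
  moreover have "star x \<in> generated_algebra S" if "x \<in> generated_algebra S" for x
    using that
    by induction (auto simp: star_add star_scaleC star_mult assms intro: generated_algebra.intros)
  moreover have "0 \<in> generated_algebra S"
    using generated_algebra.scaleC[OF generated_algebra.base[OF assms(3)], of 0]
    by (simp add: bop_scaleC_zero_left)
  ultimately show ?thesis
    unfolding star_subalgebra_of_def subalgebra_of_def
    using assms(3) by (auto intro: generated_algebra.intros)
qed

section \<open>Centred words\<close>

text \<open>\<open>k\<close> marks an algebra that contains the diagonal; the theorem takes
  \<open>None\<close>, the index of \<open>B\<close>.\<close>

locale free_star_family =
  fixes A :: "'h::chilbert_space bop set" and \<phi> :: "'h bop \<Rightarrow> complex"
    and d :: nat and p :: "nat \<Rightarrow> 'h bop"
    and \<A> :: "'i \<Rightarrow> 'h bop set" and k :: 'i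
  assumes prob_space: "tracial_wstar_prob_space A \<phi>"
    and partition: "orthogonal_projection_partition A d p"
    and star_subalgebra: "\<And>i. star_subalgebra_of A (\<A> i)"
    and free: "free_wrt \<phi> \<A>"
    and diag_subset: "diag_alg d p \<subseteq> \<A> k"
begin

abbreviation D where "D \<equiv> diag_alg d p"

lemma star_subalgebra_A: "star_subalgebra_of UNIV A"
  using prob_space by (simp add: tracial_wstar_prob_space_def von_neumann_algebra_def)

lemma A_closed:
  "0 \<in> A" "1 \<in> A" "x \<in> A \<Longrightarrow> y \<in> A \<Longrightarrow> x + y \<in> A" "x \<in> A \<Longrightarrow> c *\<^sub>C x \<in> A"
  "x \<in> A \<Longrightarrow> y \<in> A \<Longrightarrow> x * y \<in> A"
  using star_subalgebra_A by (auto simp: star_subalgebra_of_def subalgebra_of_def)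

lemma family_closed:
  "0 \<in> \<A> i" "1 \<in> \<A> i" "x \<in> \<A> i \<Longrightarrow> y \<in> \<A> i \<Longrightarrow> x + y \<in> \<A> i" "x \<in> \<A> i \<Longrightarrow> c *\<^sub>C x \<in> \<A> i"
  "x \<in> \<A> i \<Longrightarrow> y \<in> \<A> i \<Longrightarrow> x * y \<in> \<A> i" "x \<in> \<A> i \<Longrightarrow> star x \<in> \<A> i" "x \<in> \<A> i \<Longrightarrow> x \<in> A"
  using star_subalgebra[of i] by (auto simp: star_subalgebra_of_def subalgebra_of_def)

lemma phi_linear:
  "x \<in> A \<Longrightarrow> y \<in> A \<Longrightarrow> \<phi> (x + y) = \<phi> x + \<phi> y" "x \<in> A \<Longrightarrow> \<phi> (c *\<^sub>C x) = c * \<phi> x" "\<phi> 1 = 1"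
  using prob_space by (auto simp: tracial_wstar_prob_space_def state_on_def)

lemma phi_zero: "\<phi> 0 = 0"
  using phi_linear(2)[of 0 0] by (simp add: A_closed bop_scaleC_simps)

lemma sum_in_A: "(\<And>i. i \<in> S \<Longrightarrow> f i \<in> A) \<Longrightarrow> sum f S \<in> A"
  by (induction S rule: infinite_finite_induct) (simp_all add: A_closed)

lemma phi_sum: "(\<And>i. i \<in> S \<Longrightarrow> f i \<in> A) \<Longrightarrow> \<phi> (sum f S) = (\<Sum>i\<in>S. \<phi> (f i))"
  by (induction S rule: infinite_finite_induct) (simp_all add: phi_zero phi_linear sum_in_A)

lemma phi_commute: "x \<in> A \<Longrightarrow> y \<in> A \<Longrightarrow> \<phi> (x * y) = \<phi> (y * x)"
  using prob_space by (simp add: tracial_wstar_prob_space_def tracial_on_def)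

section \<open>The projections, the diagonal algebra and the kernel of the conditional
  expectation\<close>

lemma proj:
  assumes "i \<in> {1..d}"
  shows "p i \<in> A" "star (p i) = p i" "p i * p i = p i" "p i \<noteq> 0"
  using partition assms unfolding orthogonal_projection_partition_def by blast+

lemma proj_orthogonal: "i \<in> {1..d} \<Longrightarrow> j \<in> {1..d} \<Longrightarrow> i \<noteq> j \<Longrightarrow> p i * p j = 0"
  using partition unfolding orthogonal_projection_partition_def by blast

lemma phi_proj_nonzero: "i \<in> {1..d} \<Longrightarrow> \<phi> (p i) \<noteq> 0"
  using proj[of i] prob_space by (auto simp: tracial_wstar_prob_space_def faithful_on_def)

lemma proj_mult_diag: "i \<in> {1..d} \<Longrightarrow> p i * (\<Sum>j=1..d. c j *\<^sub>C p j) = c i *\<^sub>C p i"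
proof -
  assume i: "i \<in> {1..d}"
  have "p i * (\<Sum>j=1..d. c j *\<^sub>C p j) = (\<Sum>j=1..d. if j = i then c i *\<^sub>C p i else 0)"
    unfolding sum_distrib_left
    by (intro sum.cong)
      (use i proj_orthogonal in \<open>auto simp: bop_scaleC_simps proj\<close>)
  also have "\<dots> = c i *\<^sub>C p i" using i by simp
  finally show ?thesis .
qed

lemma diagI: "q = (\<Sum>i=1..d. c i *\<^sub>C p i) \<Longrightarrow> q \<in> D"
  unfolding diag_alg_def by blast

lemma diagE:
  assumes "q \<in> D"
  obtains c where "q = (\<Sum>i=1..d. c i *\<^sub>C p i)"
  using assms unfolding diag_alg_def by blast

lemma diag_one: "1 \<in> D"
  using partition
  by (intro diagI[where c = "\<lambda>_. 1"])
    (simp add: orthogonal_projection_partition_def bop_scaleC_simps)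

lemma diag_proj: "i \<in> {1..d} \<Longrightarrow> p i \<in> D"
proof (rule diagI[where c = "\<lambda>j. if j = i then 1 else 0"])
  assume i: "i \<in> {1..d}"
  have "(\<Sum>j=1..d. (if j = i then 1 else 0) *\<^sub>C p j) = (\<Sum>j=1..d. if j = i then p i else 0)"
    by (rule sum.cong) (auto simp: bop_scaleC_simps)
  then show "p i = (\<Sum>j=1..d. (if j = i then 1 else 0) *\<^sub>C p j)" using i by simp
qed

lemma diag_add: "q \<in> D \<Longrightarrow> r \<in> D \<Longrightarrow> q + r \<in> D"
  by (elim diagE, rule_tac c = "\<lambda>i. c i + ca i" in diagI)
    (simp add: bop_scaleC_add_left sum.distrib)

lemma diag_scaleC: "q \<in> D \<Longrightarrow> b *\<^sub>C q \<in> D"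
  by (elim diagE, rule_tac c = "\<lambda>i. b * c i" in diagI)
    (simp add: bop_scaleC_sum_right bop_scaleC_scaleC)

lemma diag_mult: "q \<in> D \<Longrightarrow> r \<in> D \<Longrightarrow> q * r \<in> D"
  by (elim diagE, rule_tac c = "\<lambda>i. c i * ca i" in diagI)
    (simp add: sum_distrib_right bop_mult_scaleC_left proj_mult_diag bop_scaleC_scaleC
      del: One_nat_def)

lemma diag_star: "q \<in> D \<Longrightarrow> star q \<in> D"
  by (elim diagE, rule_tac c = "\<lambda>i. cnj (c i)" in diagI)
    (simp add: star_sum star_scaleC proj)

lemma diag_in: "q \<in> D \<Longrightarrow> q \<in> \<A> k" "q \<in> D \<Longrightarrow> q \<in> A"
  using diag_subset family_closed(7) by auto

text \<open>On \<open>A\<close> this is the kernel of the conditional expectation, see \<open>cond_exp_eq_0_iff\<close>.\<close>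

definition E_centred :: "'h bop \<Rightarrow> bool" where
  "E_centred x \<longleftrightarrow> x \<in> A \<and> (\<forall>q\<in>D. \<phi> (q * x) = 0)"

lemma E_centred_iff_proj:
  assumes "x \<in> A"
  shows "E_centred x \<longleftrightarrow> (\<forall>i\<in>{1..d}. \<phi> (p i * x) = 0)"
proof
  assume *: "\<forall>i\<in>{1..d}. \<phi> (p i * x) = 0"
  show "E_centred x"
    unfolding E_centred_def
  proof (intro conjI ballI assms)
    fix q assume "q \<in> D"
    then obtain c where "q = (\<Sum>i=1..d. c i *\<^sub>C p i)" by (rule diagE)
    then have "\<phi> (q * x) = \<phi> (\<Sum>i=1..d. c i *\<^sub>C (p i * x))"
      by (simp add: sum_distrib_right bop_mult_scaleC_left)
    also have "\<dots> = (\<Sum>i=1..d. \<phi> (c i *\<^sub>C (p i * x)))"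
      by (rule phi_sum) (simp add: A_closed proj assms)
    also have "\<dots> = 0"
      using * by (intro sum.neutral) (simp add: phi_linear A_closed proj assms)
    finally show "\<phi> (q * x) = 0" .
  qed
qed (simp add: E_centred_def diag_proj)

text \<open>By traciality the coefficient of E x at \<open>p i\<close> is
  \<open>\<phi> (p i * x)\<close> divided by \<open>\<phi> (p i)\<close>; multiplying by
  \<open>p i\<close> isolates it.\<close>

lemma cond_exp_eq_0_iff:
  assumes x: "x \<in> A"
  shows "cond_exp \<phi> d p x = 0 \<longleftrightarrow> E_centred x"
proof -
  have corner: "corner_state \<phi> p i (p i * x * p i) = inverse (\<phi> (p i)) * \<phi> (p i * x)"
    if "i \<in> {1..d}" for i
  proof -
    have "\<phi> (p i * x * p i) = \<phi> (p i * (p i * x))"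
      using phi_commute[of "p i * x" "p i"] that x by (simp add: proj A_closed)
    also have "\<dots> = \<phi> (p i * x)" using that by (simp add: proj flip: mult.assoc)
    finally show ?thesis by (simp add: corner_state_def)
  qed
  show ?thesis
    unfolding E_centred_iff_proj[OF x]
  proof (intro iffI ballI)
    fix i assume E: "cond_exp \<phi> d p x = 0" and i: "i \<in> {1..d}"
    have "corner_state \<phi> p i (p i * x * p i) *\<^sub>C p i = p i * cond_exp \<phi> d p x"
      unfolding cond_exp_def by (rule proj_mult_diag[symmetric]) fact
    also have "\<dots> = 0" using E by simp
    finally have "corner_state \<phi> p i (p i * x * p i) = 0"
      using proj(4)[OF i] by (rule bop_scaleC_eq_0D)
    then show "\<phi> (p i * x) = 0" using corner[OF i] phi_proj_nonzero[OF i] by simp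
  next
    assume "\<forall>i\<in>{1..d}. \<phi> (p i * x) = 0"
    then show "cond_exp \<phi> d p x = 0"
      unfolding cond_exp_def by (simp add: corner bop_scaleC_zero_left)
  qed
qed

lemma E_centred_add: "E_centred x \<Longrightarrow> E_centred y \<Longrightarrow> E_centred (x + y)"
  by (simp add: E_centred_def A_closed distrib_left phi_linear diag_in)

lemma E_centred_mult_left: "q \<in> D \<Longrightarrow> E_centred x \<Longrightarrow> E_centred (q * x)"
  by (simp add: E_centred_def A_closed diag_in diag_mult flip: mult.assoc)

text \<open>The trace carries \<open>r\<close> round to the left, where \<open>r * q\<close> is
  again a diagonal test element.\<close>

lemma E_centred_mult_right:
  assumes r: "r \<in> D" and x: "E_centred x"
  shows "E_centred (x * r)"
  unfolding E_centred_def
proof (intro conjI ballI)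
  have xA: "x \<in> A" using x by (simp add: E_centred_def)
  then show "x * r \<in> A" using r by (simp add: A_closed diag_in)
  fix q assume q: "q \<in> D"
  have "\<phi> (q * (x * r)) = \<phi> (r * q * x)"
    using phi_commute[of "q * x" r] xA q r by (simp add: mult.assoc A_closed diag_in)
  also have "\<dots> = 0" using x q r diag_mult by (auto simp: E_centred_def)
  finally show "\<phi> (q * (x * r)) = 0" .
qed

lemma E_centred_phi: "E_centred x \<Longrightarrow> \<phi> x = 0"
  using diag_one by (force simp: E_centred_def)

text \<open>Testing against \<open>star q \<in> D\<close> reduces the claim to faithfulness.\<close>

lemma E_centred_diag:
  assumes q: "q \<in> D" and "E_centred q"
  shows "q = 0"
proof -
  have "\<phi> (star q * q) = 0" using assms diag_star by (simp add: E_centred_def)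
  then show ?thesis
    using prob_space diag_in(2)[OF q] by (simp add: tracial_wstar_prob_space_def faithful_on_def)
qed

section \<open>Centring of letters and spans of alternating centred words\<close>

definition centre :: "'h bop \<Rightarrow> 'h bop" where
  "centre x = x + (- \<phi> x) *\<^sub>C 1"

lemma centre_split: "x = centre x + \<phi> x *\<^sub>C 1"
  using bop_scaleC_add_left[of "- \<phi> x" "\<phi> x" 1]
  by (simp add: centre_def bop_scaleC_zero_left add.assoc)

lemma centre_in: "x \<in> \<A> i \<Longrightarrow> centre x \<in> \<A> i" "q \<in> D \<Longrightarrow> centre q \<in> D"
  by (simp_all add: centre_def family_closed diag_add diag_scaleC diag_one)

lemma phi_centre: "x \<in> A \<Longrightarrow> \<phi> (centre x) = 0"
  by (simp add: centre_def phi_linear A_closed)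

lemma mult_centre_split: "x * y = centre x * y + \<phi> x *\<^sub>C y"
  by (subst centre_split[of x]) (simp add: distrib_right bop_scaleC_simps)

text \<open>The index of the first letter is recorded because it decides which letters may be
  multiplied on the left. Sums are allowed at every stage, since centring a letter splits a word
  into several.\<close>

inductive word_span :: "'i \<Rightarrow> 'h bop \<Rightarrow> bool" where
  single: "x \<in> \<A> i \<Longrightarrow> \<phi> x = 0 \<Longrightarrow> word_span i x"
| mult: "x \<in> \<A> i \<Longrightarrow> \<phi> x = 0 \<Longrightarrow> word_span j z \<Longrightarrow> i \<noteq> j \<Longrightarrow> word_span i (x * z)"
| add: "word_span i x \<Longrightarrow> word_span i y \<Longrightarrow> word_span i (x + y)"
| scaleC: "word_span i x \<Longrightarrow> word_span i (c *\<^sub>C x)"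

lemma word_span_in: "word_span i x \<Longrightarrow> x \<in> A"
  by (induction rule: word_span.induct) (auto simp: A_closed family_closed(7))

lemma prod_list_in:
  "\<forall>(i, x)\<in>set w. x \<in> \<A> i \<Longrightarrow> prod_list (map snd w) \<in> A"
  by (induction w) (auto simp: A_closed family_closed(7))

text \<open>Freeness speaks of complete lists of letters, whereas spans contain sums inside words.
  The prefix \<open>w\<close> collects the letters read so far, and freeness applies once the last
  one has been read.\<close>

lemma phi_word_mult_word_span:
  assumes "word_span i z" "distinct_adj (map fst w)" "\<forall>(j, x)\<in>set w. x \<in> \<A> j \<and> \<phi> x = 0"
    "w \<noteq> [] \<Longrightarrow> fst (last w) \<noteq> i"
  shows "\<phi> (prod_list (map snd w) * z) = 0"
  using assms
proof (induction arbitrary: w rule: word_span.induct)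
  case (single x i)
  have "\<phi> (prod_list (map snd (w @ [(i, x)]))) = 0"
    using single
    by (intro free[unfolded free_wrt_def, rule_format])
      (cases "w = []"; auto simp: distinct_adj_append_iff last_map)
  then show ?case by simp
next
  case (mult x i j z)
  have "\<phi> (prod_list (map snd (w @ [(i, x)])) * z) = 0"
    using mult by (intro mult.IH) (auto simp: distinct_adj_append_iff last_map)
  then show ?case by (simp add: mult.assoc)
next
  case (add i x y)
  have "prod_list (map snd w) \<in> A" using add.prems by (intro prod_list_in) auto
  moreover have "\<phi> (prod_list (map snd w) * x) = 0"
    by (rule add.IH(1)) (use add.prems in blast)+
  moreover have "\<phi> (prod_list (map snd w) * y) = 0"
    by (rule add.IH(2)) (use add.prems in blast)+
  ultimately show ?case
    using add.hyps word_span_in by (simp add: distrib_left phi_linear A_closed)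
next
  case (scaleC i x c)
  have "prod_list (map snd w) \<in> A" using scaleC.prems by (intro prod_list_in) auto
  moreover have "\<phi> (prod_list (map snd w) * x) = 0"
    by (rule scaleC.IH) (use scaleC.prems in blast)+
  ultimately show ?case
    using scaleC.hyps word_span_in by (simp add: bop_scaleC_simps phi_linear A_closed)
qed

lemma phi_word_span: "word_span i z \<Longrightarrow> \<phi> z = 0"
  using phi_word_mult_word_span[of i z "[]"] by simp

lemma word_span_mult_one:
  assumes s: "s \<noteq> k" and a: "a \<in> \<A> s" "\<phi> a = 0" and e: "e \<in> \<A> k"
  shows "word_span s (a * e)"
proof -
  have "a * e = a * centre e + \<phi> e *\<^sub>C a"
    by (subst centre_split[of e]) (simp add: distrib_left bop_scaleC_simps)
  moreover have "word_span s (a * centre e)"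
    using assms by (intro word_span.mult[where j = k] word_span.single)
      (auto simp: centre_in phi_centre family_closed(7)[OF e])
  ultimately show ?thesis using a by (auto intro: word_span.intros)
qed

text \<open>The centred part of \<open>e\<close> separates \<open>a\<close> from \<open>z\<close> by
  a letter from \<open>\<A> k\<close>. The scalar part leaves \<open>a * z\<close>, which alternates
  only for \<open>s \<noteq> t\<close>; hence the condition on \<open>\<phi> e\<close>.\<close>

lemma word_span_mult:
  assumes s: "s \<noteq> k" and a: "a \<in> \<A> s" "\<phi> a = 0" and e: "e \<in> \<A> k"
    and z: "word_span t z" "t \<noteq> k" "s = t \<Longrightarrow> \<phi> e = 0"
  shows "word_span s (a * (e * z))"
proof -
  have centred: "word_span s (a * (f * z))" if "f \<in> \<A> k" "\<phi> f = 0" for f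
    using assms that by (intro word_span.mult[of a s k] word_span.mult[of f k t]) auto
  show ?thesis
  proof (cases "s = t")
    case True
    then show ?thesis using centred e z by simp
  next
    case False
    have "a * (e * z) = a * (centre e * z) + \<phi> e *\<^sub>C (a * z)"
      by (simp add: mult_centre_split[of e z] distrib_left bop_scaleC_simps)
    moreover have "word_span s (a * (centre e * z))"
      using e by (intro centred) (auto simp: centre_in phi_centre family_closed(7))
    ultimately show ?thesis using False a z by (auto intro: word_span.intros)
  qed
qed

section \<open>The subalgebras generated with the diagonal\<close>

text \<open>\<open>diag_complement i\<close> is \<open>V\<close>; the words of \<open>diag_word_span i\<close> lack the leading factor \<open>q\<^sub>0\<close>.\<close>

inductive diag_word_span :: "'i \<Rightarrow> 'h bop \<Rightarrow> bool" for i where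
  single: "a \<in> \<A> i \<Longrightarrow> \<phi> a = 0 \<Longrightarrow> q \<in> D \<Longrightarrow> diag_word_span i (a * q)"
| mult: "a \<in> \<A> i \<Longrightarrow> \<phi> a = 0 \<Longrightarrow> q \<in> D \<Longrightarrow> \<phi> q = 0 \<Longrightarrow> diag_word_span i u \<Longrightarrow>
    diag_word_span i (a * (q * u))"
| add: "diag_word_span i u \<Longrightarrow> diag_word_span i v \<Longrightarrow> diag_word_span i (u + v)"
| scaleC: "diag_word_span i u \<Longrightarrow> diag_word_span i (c *\<^sub>C u)"

inductive diag_complement :: "'i \<Rightarrow> 'h bop \<Rightarrow> bool" for i where
  base: "q \<in> D \<Longrightarrow> diag_word_span i u \<Longrightarrow> diag_complement i (q * u)"
| add: "diag_complement i x \<Longrightarrow> diag_complement i y \<Longrightarrow> diag_complement i (x + y)"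

definition diag_decomposed :: "'i \<Rightarrow> 'h bop set" where
  "diag_decomposed i = {q + x | q x. q \<in> D \<and> diag_complement i x}"

lemma diag_word_span_zero: "diag_word_span i 0"
  using diag_word_span.single[of 0 i 1] by (simp add: family_closed phi_zero diag_one)

lemma diag_complement_word_span: "diag_word_span i u \<Longrightarrow> diag_complement i u"
  using diag_complement.base[OF diag_one] by force

lemma diag_complement_scaleC: "diag_complement i x \<Longrightarrow> diag_complement i (c *\<^sub>C x)"
proof (induction rule: diag_complement.induct)
  case (base q u)
  then show ?case using diag_complement.base[OF diag_scaleC[of q c], of i u]
    by (simp add: bop_scaleC_simps)
qed (simp add: bop_scaleC_simps diag_complement.add)

lemma diag_complement_mult: "diag_complement i x \<Longrightarrow> q \<in> D \<Longrightarrow> diag_complement i (q * x)"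
proof (induction rule: diag_complement.induct)
  case (base r u)
  then show ?case using diag_complement.base[OF diag_mult[of q r], of i u]
    by (simp add: mult.assoc)
qed (simp add: distrib_left diag_complement.add)

lemma decomposedI: "q \<in> D \<Longrightarrow> diag_complement i x \<Longrightarrow> q + x \<in> diag_decomposed i"
  unfolding diag_decomposed_def by blast

lemma decomposedE:
  assumes "x \<in> diag_decomposed i"
  obtains q u where "x = q + u" "q \<in> D" "diag_complement i u"
  using assms unfolding diag_decomposed_def by blast

lemma decomposed_diag: "q \<in> D \<Longrightarrow> q \<in> diag_decomposed i"
  using decomposedI[OF _ diag_complement_word_span[OF diag_word_span_zero], of q i] by simp

lemma decomposed_complement: "diag_complement i x \<Longrightarrow> x \<in> diag_decomposed i"
  using decomposedI[OF diag_scaleC[OF diag_one, of 0]] by (simp add: bop_scaleC_zero_left)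

lemma decomposed_add:
  assumes "x \<in> diag_decomposed i" "y \<in> diag_decomposed i"
  shows "x + y \<in> diag_decomposed i"
proof -
  obtain q u where x: "x = q + u" "q \<in> D" "diag_complement i u"
    using assms(1) by (rule decomposedE)
  obtain r v where y: "y = r + v" "r \<in> D" "diag_complement i v"
    using assms(2) by (rule decomposedE)
  have "(q + r) + (u + v) \<in> diag_decomposed i"
    using x y by (intro decomposedI diag_add diag_complement.add)
  then show ?thesis using x y by (simp add: ac_simps)
qed

lemma decomposed_scaleC: "x \<in> diag_decomposed i \<Longrightarrow> c *\<^sub>C x \<in> diag_decomposed i"
  by (erule decomposedE)
    (simp add: bop_scaleC_add_right decomposedI diag_scaleC diag_complement_scaleC)

lemma decomposed_mult_diag: "x \<in> diag_decomposed i \<Longrightarrow> q \<in> D \<Longrightarrow> q * x \<in> diag_decomposed i"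
  by (erule decomposedE) (simp add: distrib_left decomposedI diag_mult diag_complement_mult)

text \<open>The product of \<open>a\<close> with the first letter is a letter again, though perhaps
  not centred. Its scalar part deletes that letter and leaves an element of \<open>D\<close> or a
  shorter word with a leading diagonal factor.\<close>

lemma decomposed_mult_word_span:
  assumes "diag_word_span i u" "a \<in> \<A> i" "\<phi> a = 0"
  shows "a * u \<in> diag_decomposed i"
  using assms
proof (induction rule: diag_word_span.induct)
  case (single b q)
  have ab: "a * b \<in> \<A> i" using single by (simp add: family_closed)
  have "a * (b * q) = centre (a * b) * q + \<phi> (a * b) *\<^sub>C q"
    using mult_centre_split[of "a * b" q] by (simp add: mult.assoc)
  moreover have "diag_word_span i (centre (a * b) * q)"
    using ab single by (intro diag_word_span.single) (auto simp: centre_in phi_centre family_closed(7))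
  ultimately show ?case
    using single.hyps
    by (simp add: decomposed_add decomposed_scaleC decomposed_diag
        decomposed_complement diag_complement_word_span)
next
  case (mult b q u)
  have ab: "a * b \<in> \<A> i" using mult by (simp add: family_closed)
  have "a * (b * (q * u)) = centre (a * b) * (q * u) + \<phi> (a * b) *\<^sub>C (q * u)"
    using mult_centre_split[of "a * b" "q * u"] by (simp add: mult.assoc)
  moreover have "diag_word_span i (centre (a * b) * (q * u))"
    using ab mult by (intro diag_word_span.mult) (auto simp: centre_in phi_centre family_closed(7))
  ultimately show ?case
    using mult.hyps
    by (simp add: decomposed_add decomposed_scaleC decomposed_complement
        diag_complement.base diag_complement_word_span)
qed (auto simp: distrib_left bop_scaleC_simps intro: decomposed_add decomposed_scaleC)

text \<open>Centring the leading coefficient \<open>q\<close> gives a word with centred inner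
  coefficient; the scalar part puts \<open>a\<close> directly before \<open>u\<close>, the situation
  of \<open>decomposed_mult_word_span\<close>.\<close>

lemma decomposed_mult_centred_complement:
  assumes "diag_complement i x" "a \<in> \<A> i" "\<phi> a = 0"
  shows "a * x \<in> diag_decomposed i"
  using assms
proof (induction rule: diag_complement.induct)
  case (base q u)
  have "a * (q * u) = a * (centre q * u) + \<phi> q *\<^sub>C (a * u)"
    by (simp add: mult_centre_split[of q u] distrib_left bop_scaleC_simps)
  moreover have "diag_word_span i (a * (centre q * u))"
    using base by (intro diag_word_span.mult) (auto simp: centre_in phi_centre diag_in)
  ultimately show ?case
    using base decomposed_mult_word_span
    by (simp add: decomposed_add decomposed_scaleC decomposed_complement
        diag_complement_word_span)
qed (simp add: distrib_left decomposed_add)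

lemma decomposed_mult_family:
  assumes x: "x \<in> diag_decomposed i" and a: "a \<in> \<A> i"
  shows "a * x \<in> diag_decomposed i"
proof -
  have a0: "centre a \<in> \<A> i" "\<phi> (centre a) = 0"
    using a by (auto simp: centre_in phi_centre family_closed(7))
  obtain q u where qu: "x = q + u" "q \<in> D" "diag_complement i u"
    using x by (rule decomposedE)
  have "centre a * q \<in> diag_decomposed i"
    using a0 qu by (intro decomposed_complement diag_complement_word_span diag_word_span.single)
  moreover have "centre a * u \<in> diag_decomposed i"
    using a0 qu decomposed_mult_centred_complement by blast
  ultimately have "centre a * x \<in> diag_decomposed i"
    using qu by (simp add: distrib_left decomposed_add)
  then show ?thesis
    unfolding mult_centre_split[of a x] using x by (intro decomposed_add decomposed_scaleC)
qed

lemma generated_subset_decomposed: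
  assumes "x \<in> generated_algebra (D \<union> \<A> i)"
  shows "x \<in> diag_decomposed i"
proof -
  \<comment> \<open>Stability under left multiplication by generators passes to the whole algebra,
    and \<open>y = 1\<close> then gives the inclusion; closure of D + V under products is never
    proved separately.\<close>
  have "x * y \<in> diag_decomposed i" if "y \<in> diag_decomposed i" for y
    using assms that
  proof (induction arbitrary: y)
    case (base x)
    then show ?case using decomposed_mult_diag decomposed_mult_family by auto
  qed (auto simp: distrib_right bop_scaleC_simps mult.assoc
      intro: decomposed_add decomposed_scaleC)
  from this[OF decomposed_diag[OF diag_one]] show ?thesis by simp
qed

section \<open>Freeness with amalgamation\<close>

text \<open>Only the last letter of \<open>u\<close> and its coefficient meet \<open>y\<close>, so
  the hypothesis on \<open>y\<close> concerns just that pair. The inner coefficients are centred, as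
  \<open>word_span_mult\<close> demands between two letters from \<open>\<A> s\<close>.\<close>

lemma diag_word_span_mult_word_span:
  assumes s: "s \<noteq> k" and u: "diag_word_span s u"
    and y: "\<And>a q. a \<in> \<A> s \<Longrightarrow> \<phi> a = 0 \<Longrightarrow> q \<in> D \<Longrightarrow> word_span s (a * (q * y))"
  shows "word_span s (u * y)"
  using u
proof (induction rule: diag_word_span.induct)
  case (mult a q u)
  have "word_span s (a * (q * (u * y)))"
    using s mult by (intro word_span_mult) (auto simp: diag_in)
  then show ?case by (simp add: mult.assoc)
qed (simp_all add: y mult.assoc distrib_right bop_mult_scaleC_left word_span.add word_span.scaleC)

text \<open>An alternating product of \<open>E\<close>-centred factors lies in \<open>outer_span s\<close> if it starts in
  \<open>alg(D, \<A> s)\<close>, and in \<open>inner_span\<close> if it starts in \<open>\<A> k\<close>.\<close>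

inductive outer_span :: "'i \<Rightarrow> 'h bop \<Rightarrow> bool" for s where
  base: "q \<in> D \<Longrightarrow> word_span s z \<Longrightarrow> outer_span s (q * z)"
| add: "outer_span s x \<Longrightarrow> outer_span s y \<Longrightarrow> outer_span s (x + y)"

inductive inner_span :: "'h bop \<Rightarrow> bool" where
  single: "b \<in> \<A> k \<Longrightarrow> E_centred b \<Longrightarrow> inner_span b"
| mult: "b \<in> \<A> k \<Longrightarrow> E_centred b \<Longrightarrow> word_span s z \<Longrightarrow> s \<noteq> k \<Longrightarrow> inner_span (b * z)"
| add: "inner_span x \<Longrightarrow> inner_span y \<Longrightarrow> inner_span (x + y)"

text \<open>The test element merges with \<open>q\<close> into a letter \<open>t\<close> from
  \<open>\<A> k\<close>; its centred part prolongs the alternating word, its scalar part multiplies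
  \<open>\<phi> z = 0\<close>.\<close>

lemma E_centred_diag_mult_word_span:
  assumes s: "s \<noteq> k" and q: "q \<in> D" and z: "word_span s z"
  shows "E_centred (q * z)"
  unfolding E_centred_def
proof (intro conjI ballI)
  show "q * z \<in> A" using q z word_span_in by (simp add: A_closed diag_in)
  fix r assume r: "r \<in> D"
  define t where "t = r * q"
  have t: "t \<in> D" using r q by (simp add: t_def diag_mult)
  have c: "word_span k (centre t * z)"
    using t s z by (intro word_span.mult[where j = s]) (auto simp: centre_in phi_centre diag_in)
  have "\<phi> (t * z) = \<phi> (centre t * z) + \<phi> t * \<phi> z"
    unfolding mult_centre_split[of t z]
    using c z word_span_in by (simp add: phi_linear A_closed)
  then show "\<phi> (r * (q * z)) = 0"
    using c z phi_word_span by (simp add: t_def mult.assoc)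
qed

lemma E_centred_outer_span: "outer_span s x \<Longrightarrow> s \<noteq> k \<Longrightarrow> E_centred x"
  by (induction rule: outer_span.induct) (auto simp: E_centred_diag_mult_word_span E_centred_add)

lemma E_centred_inner_span: "inner_span x \<Longrightarrow> E_centred x"
proof (induction rule: inner_span.induct)
  case (mult b s z)
  have "\<phi> (q * (b * z)) = 0" if q: "q \<in> D" for q
  proof -
    have "\<phi> (q * b) = 0" using mult q by (simp add: E_centred_def)
    then have "word_span k (q * b * z)"
      using mult q by (intro word_span.mult[where j = s]) (auto simp: family_closed diag_in)
    then show ?thesis using phi_word_span by (simp add: mult.assoc)
  qed
  then show ?case
    using mult word_span_in by (auto simp: E_centred_def A_closed)
qed (auto intro: E_centred_add)

text \<open>Neighbouring diagonal factors merge into one that may have a scalar part, which is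
  harmless because \<open>s \<noteq> t\<close>.\<close>

lemma outer_span_word_span:
  assumes "outer_span t y" "s \<noteq> k" "t \<noteq> k" "s \<noteq> t" "a \<in> \<A> s" "\<phi> a = 0" "q \<in> D"
  shows "word_span s (a * (q * y))"
  using assms
proof (induction rule: outer_span.induct)
  case (base r z)
  have "word_span s (a * (q * r * z))"
    using base by (intro word_span_mult[where t = t]) (auto simp: diag_in diag_mult)
  then show ?case by (simp add: mult.assoc)
qed (simp add: distrib_left word_span.add)

text \<open>The letter after \<open>b\<close> may come from \<open>\<A> s\<close> again, so
  \<open>q * b\<close> has to be centred; E-centredness of \<open>b\<close> provides this for every
  \<open>q\<close>.\<close>

lemma inner_span_word_span:
  assumes "inner_span y" "s \<noteq> k" "a \<in> \<A> s" "\<phi> a = 0" "q \<in> D"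
  shows "word_span s (a * (q * y))"
  using assms
proof (induction rule: inner_span.induct)
  case (single b)
  then show ?case by (intro word_span_mult_one) (auto simp: family_closed diag_in)
next
  case (mult b t z)
  have "word_span s (a * (q * b * z))"
    using mult by (intro word_span_mult[where t = t])
      (auto simp: diag_in family_closed E_centred_mult_left E_centred_phi)
  then show ?case by (simp add: mult.assoc)
qed (simp add: distrib_left word_span.add)

lemma diag_complement_mult_outer_span:
  assumes s: "s \<noteq> k" and x: "diag_complement s x"
    and y: "\<And>a q. a \<in> \<A> s \<Longrightarrow> \<phi> a = 0 \<Longrightarrow> q \<in> D \<Longrightarrow> word_span s (a * (q * y))"
  shows "outer_span s (x * y)"
  using x
proof (induction rule: diag_complement.induct)
  case (base q u)
  have "word_span s (u * y)"
    by (rule diag_word_span_mult_word_span[OF s base(2)]) (rule y)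
  with base show ?case by (simp add: mult.assoc outer_span.base)
qed (simp add: distrib_right outer_span.add)

lemma diag_complement_outer_span: "s \<noteq> k \<Longrightarrow> diag_complement s x \<Longrightarrow> outer_span s x"
  using diag_complement_mult_outer_span[of s x 1] by (simp add: word_span_mult_one diag_in)

lemma mult_outer_span:
  assumes "outer_span s y" "s \<noteq> k" "b \<in> \<A> k" "E_centred b"
  shows "inner_span (b * y)"
  using assms
proof (induction rule: outer_span.induct)
  case (base q z)
  have "inner_span (b * q * z)"
    using base by (intro inner_span.mult) (auto simp: family_closed diag_in E_centred_mult_right)
  then show ?case by (simp add: mult.assoc)
qed (simp add: distrib_left inner_span.add)

text \<open>Elements of V are E-centred, so the diagonal component of \<open>x\<close> is E-centred
  too and vanishes by \<open>E_centred_diag\<close>.\<close>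

lemma generated_E_centred_complement:
  assumes i: "i \<noteq> k" and x: "x \<in> generated_algebra (D \<union> \<A> i)" "E_centred x"
  shows "diag_complement i x"
proof -
  obtain q u where qu: "x = q + u" "q \<in> D" "diag_complement i u"
    using generated_subset_decomposed[OF x(1)] by (rule decomposedE)
  have u: "E_centred u"
    using qu i diag_complement_outer_span E_centred_outer_span by blast
  have "\<phi> (r * q) = 0" if r: "r \<in> D" for r
  proof -
    have "\<phi> (r * x) = \<phi> (r * q) + \<phi> (r * u)"
      using qu u r by (simp add: distrib_left phi_linear A_closed diag_in E_centred_def)
    then show ?thesis using x u r by (simp add: E_centred_def)
  qed
  then have "q = 0" using qu by (intro E_centred_diag) (auto simp: E_centred_def diag_in)
  then show ?thesis using qu by simp
qed

section \<open>The witnessing subalgebras and their freeness over the diagonal\<close>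

definition amalgam :: "'i \<Rightarrow> 'h bop set" where
  "amalgam i = (if i = k then \<A> k else generated_algebra (D \<union> \<A> i))"

lemma amalgam_star_subalgebra: "star_subalgebra_of A (amalgam i)"
proof (cases "i = k")
  case False
  have "star_subalgebra_of A (generated_algebra (D \<union> \<A> i))"
    by (rule star_subalgebra_generated[OF star_subalgebra_A])
      (auto simp: diag_in diag_one diag_star family_closed)
  with False show ?thesis by (simp add: amalgam_def)
qed (simp add: amalgam_def star_subalgebra)

lemma diag_subset_amalgam: "D \<subseteq> amalgam i"
  and subset_amalgam: "\<A> i \<subseteq> amalgam i"
  using diag_subset by (auto simp: amalgam_def intro: generated_algebra.base)

lemma alternating_word_span:
  assumes "w \<noteq> []" "distinct_adj (map fst w)"
    "\<forall>(i, x)\<in>set w. x \<in> amalgam i \<and> E_centred x"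
  shows "if fst (hd w) = k then inner_span (prod_list (map snd w))
    else outer_span (fst (hd w)) (prod_list (map snd w))"
  using assms
proof (induction w)
  case (Cons l w)
  obtain i x where l: "l = (i, x)" by force
  have x: "x \<in> amalgam i" "E_centred x" using Cons.prems l by auto
  let ?y = "prod_list (map snd w)"
  show ?case
  proof (cases "w = []")
    case True
    with x l show ?thesis
      by (auto simp: amalgam_def inner_span.single generated_E_centred_complement
          diag_complement_outer_span)
  next
    case False
    define j where "j = fst (hd w)"
    have ij: "i \<noteq> j" using Cons.prems False l by (cases w) (auto simp: j_def)
    have "distinct_adj (map fst w)" using Cons.prems by (cases w) auto
    then have y: "if j = k then inner_span ?y else outer_span j ?y"
      using Cons.IH False Cons.prems by (auto simp: j_def)
    show ?thesis
    proof (cases "i = k")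
      case True
      then show ?thesis using x y ij l mult_outer_span[of j ?y x] by (auto simp: amalgam_def)
    next
      case False
      \<comment> \<open>The tail starts either in \<open>\<A> k\<close> with an E-centred factor or
        in an algebra with index \<open>j \<noteq> i\<close>; both kinds can follow a letter from
        \<open>\<A> i\<close>.\<close>
      have "word_span i (a * (q * ?y))" if "a \<in> \<A> i" "\<phi> a = 0" "q \<in> D" for a q
        using that y ij False inner_span_word_span outer_span_word_span
        by (auto split: if_splits)
      then have "outer_span i (x * ?y)"
        using False x
        by (intro diag_complement_mult_outer_span generated_E_centred_complement)
          (auto simp: amalgam_def)
      then show ?thesis using False l by simp
    qed
  qed
qed simp

lemma amalgam_free: "free_wrt (cond_exp \<phi> d p) amalgam"
  unfolding free_wrt_def
proof (intro allI impI, elim conjE)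
  fix w :: "('i \<times> 'h bop) list"
  assume w: "w \<noteq> []" "distinct_adj (map fst w)"
    and *: "\<forall>(i, x)\<in>set w. x \<in> amalgam i \<and> cond_exp \<phi> d p x = 0"
  have sub: "x \<in> A" if "x \<in> amalgam i" for i x
    using that amalgam_star_subalgebra[of i]
    by (auto simp: star_subalgebra_of_def subalgebra_of_def)
  have "\<forall>(i, x)\<in>set w. x \<in> amalgam i \<and> E_centred x"
    using * sub cond_exp_eq_0_iff by fast
  then have "E_centred (prod_list (map snd w))"
    using alternating_word_span[OF w] E_centred_inner_span E_centred_outer_span
    by (auto split: if_splits)
  then show "cond_exp \<phi> d p (prod_list (map snd w)) = 0"
    using cond_exp_eq_0_iff by (simp add: E_centred_def)
qed

end

theorem proposition3p4:
  fixes A B :: "'h::chilbert_space bop set"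
    and \<phi> :: "'h bop \<Rightarrow> complex"
    and d :: nat and p :: "nat \<Rightarrow> 'h bop"
    and y :: "nat \<Rightarrow> 'h bop"
  assumes "tracial_wstar_prob_space A \<phi>"
    and "orthogonal_projection_partition A d p"
    and "\<And>s. y s \<in> A"
    and "\<And>s. star (y s) * y s = y s * star (y s)"
    and "subalgebra_of A B"
    and "diag_alg d p \<subseteq> B"
    and "phi_free A \<phi> (adjoin_singletons B y)"
  shows "free_amalgamated A \<phi> d p (adjoin_singletons B y)"
proof -
  obtain \<A> where \<A>: "\<And>i. star_subalgebra_of A (\<A> i)" "\<And>i. adjoin_singletons B y i \<subseteq> \<A> i"
    "free_wrt \<phi> \<A>"
    using assms(7) unfolding phi_free_def by blast
  \<comment> \<open>\<open>None\<close> indexes \<open>B\<close>, so the diagonal lies in the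
    algebra at \<open>None\<close>.\<close>
  have "B \<subseteq> \<A> None" using \<A>(2)[of None] by (simp add: adjoin_singletons_def)
  then interpret free_star_family A \<phi> d p \<A> None
    using assms \<A> by unfold_locales auto
  show ?thesis
    unfolding free_amalgamated_def
    using amalgam_star_subalgebra diag_subset_amalgam subset_amalgam amalgam_free \<A>(2) by blast
qed

end
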